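(* Let $(X,T)$ be a topologically transitive dynamical system without isolated points. Then there are Cantor sets $C_1\subseteq C_2\subseteq\cdots$ in $X$ such that $K=\bigcup_{n=1}^{\infty}C_n$ is a dense rigid subset of $X$ and, for each $N\in\mathbb N$, $C_N$ is uniformly rigid. If in addition, for each $n\in\mathbb N$, $Prox_n(X)$ is dense in $X^n$, then we can moreover require that for each $N\in\mathbb N$, $C_N$ is uniformly proximal, whence $K$ is a proximal set.
   Context: A dynamical system (TDS) $(X,T)$ is a nonempty compact metric space $(X,d)$ with a continuous surjective map $T:X\to X$. It is (topologically) transitive if for all nonempty open $U,V\subseteq X$ there is $n\in\mathbb Z_+$ with $U\cap T^{-n}V\neq\emptyset$. A subset $K\subseteq X$ is rigid if there is a sequence $n_k\nearrow+\infty$ with $\lim_k T^{n_k}x=x$ for every $x\in K$. It is uniformly rigid if for every $\epsilon>0$ there is an integer $n\ge 1$ with $d(T^nx,x)<\epsilon$ for all $x\in K$. It is uniformly proximal if for every $\epsilon>0$ there is $n\in\mathbb Z_+$ with $\mathrm{diam}\,T^nK<\epsilon$. It is proximal if every finite subset of $K$ is uniformly proximal. $Prox_n(X)$ is the set of $(x_1,\dots,x_n)\in X^n$ such that for every $\epsilon>0$ there is $m\in\mathbb N$ with $\mathrm{diam}\{T^mx_1,\dots,T^mx_n\}<\epsilon$. *)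

theory Defs
  imports "HOL-Analysis.Analysis"
begin

text \<open>
  The phase space is a compact subset \<open>X\<close> of a metric-space type. The map \<open>T\<close> is a total
  function on the type, but only its restriction to \<open>X\<close> matters; its iterates are \<open>T ^^ n\<close>.
\<close>

definition dynamical_system :: "'a::metric_space set \<Rightarrow> ('a \<Rightarrow> 'a) \<Rightarrow> bool" where
  "dynamical_system X T \<longleftrightarrow> X \<noteq> {} \<and> compact X \<and> continuous_on X T \<and> T ` X = X"

definition topologically_transitive :: "'a::metric_space set \<Rightarrow> ('a \<Rightarrow> 'a) \<Rightarrow> bool" where
  "topologically_transitive X T \<longleftrightarrow>
    (\<forall>U V. openin (top_of_set X) U \<and> U \<noteq> {} \<and> openin (top_of_set X) V \<and> V \<noteq> {} \<longrightarrow>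
      (\<exists>n::nat. U \<inter> (T ^^ n) -` V \<noteq> {}))"

definition rigid :: "('a::metric_space \<Rightarrow> 'a) \<Rightarrow> 'a set \<Rightarrow> bool" where
  "rigid T K \<longleftrightarrow>
    (\<exists>n::nat \<Rightarrow> nat. strict_mono n \<and> (\<forall>x\<in>K. (\<lambda>k. (T ^^ n k) x) \<longlonglongrightarrow> x))"

definition uniformly_rigid :: "('a::metric_space \<Rightarrow> 'a) \<Rightarrow> 'a set \<Rightarrow> bool" where
  "uniformly_rigid T K \<longleftrightarrow> (\<forall>\<epsilon>>0. \<exists>n\<ge>1. \<forall>x\<in>K. dist ((T ^^ n) x) x < \<epsilon>)"

text \<open>
  The library's \<open>diameter\<close> is a supremum of reals, so it is meaningful
  only for bounded sets; all sets below lie in the compact set \<open>X\<close>. The empty set has diameter 0.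
\<close>

definition uniformly_proximal :: "('a::metric_space \<Rightarrow> 'a) \<Rightarrow> 'a set \<Rightarrow> bool" where
  "uniformly_proximal T K \<longleftrightarrow> (\<forall>\<epsilon>>0. \<exists>n. diameter ((T ^^ n) ` K) < \<epsilon>)"

definition proximal :: "('a::metric_space \<Rightarrow> 'a) \<Rightarrow> 'a set \<Rightarrow> bool" where
  "proximal T K \<longleftrightarrow> (\<forall>F. finite F \<and> F \<subseteq> K \<longrightarrow> uniformly_proximal T F)"

text \<open>
  Points of \<open>X\<^sup>n\<close> are functions in \<open>{1..n} \<rightarrow>\<^sub>E X\<close> (with value \<open>undefined\<close> off \<open>{1..n}\<close>).
\<close>

definition power_space :: "'a::metric_space set \<Rightarrow> nat \<Rightarrow> (nat \<Rightarrow> 'a) topology" where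
  "power_space X n = product_topology (\<lambda>_. top_of_set X) {1..n}"

definition Prox :: "'a::metric_space set \<Rightarrow> ('a \<Rightarrow> 'a) \<Rightarrow> nat \<Rightarrow> (nat \<Rightarrow> 'a) set" where
  "Prox X T n = {x \<in> {1..n} \<rightarrow>\<^sub>E X.
     \<forall>\<epsilon>>0. \<exists>m\<ge>1. diameter ((\<lambda>i. (T ^^ m) (x i)) ` {1..n}) < \<epsilon>}"

definition dense_in :: "'b topology \<Rightarrow> 'b set \<Rightarrow> bool" where
  "dense_in Y D \<longleftrightarrow> D \<subseteq> topspace Y \<and> Y closure_of D = topspace Y"

text \<open>A Cantor set is a homeomorphic copy of \<open>{0,1}\<^sup>\<nat>\<close>.\<close>

definition cantor_set :: "'a::metric_space set \<Rightarrow> bool" where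
  "cantor_set C \<longleftrightarrow>
    top_of_set C homeomorphic_space
      product_topology (\<lambda>_::nat. discrete_topology (UNIV :: bool set)) UNIV"

end

theory Submission
  imports Defs
begin

text \<open>
  The Cantor sets are built by fusion. At stage \<open>k \<ge> 1\<close> there are \<open>2\<^sup>k\<close> disjoint small closed cells
  of \<open>X\<close>, indexed by the bit strings of length \<open>k\<close>; each cell contains a nonempty relatively open
  set, so it can be refined further. The two children of a string other than \<open>0\<^sup>k\<close> lie in its
  cell, whereas both children of \<open>0\<^sup>k\<close> lie in the \<open>k\<close>-th member of a countable pi-base of
  \<open>X\<close>. The cells below \<open>0\<^sup>j1\<close> shrink to a Cantor set \<open>D\<^sub>j\<close>; as \<open>D\<^sub>j\<close> lies in the \<open>j\<close>-th member of
  the pi-base, the sets \<open>C\<^sub>N = D\<^sub>0 \<union> \<dots> \<union> D\<^bsub>N-1\<^esub>\<close> increase to a dense set, and \<open>C\<^sub>N\<close> lies in the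
  union of the cells of stage \<open>N\<close>.

  Any requirement on stage \<open>k\<close> that passes to subsets, and that finitely many open sets can always be
  shrunk to meet jointly, can be imposed on the union of the stage-\<open>k\<close> cells, hence on \<open>C\<^sub>k\<close>
  (lemma \<open>increasing_cantor_sets\<close>). Two requirements are used.

  \<^item> Some \<open>T\<^sup>n\<close> with \<open>n \<ge> k\<close> moves all points by less than \<open>1/(k+1)\<close> (\<open>shrinks_near_return\<close>). By
    transitivity the open sets \<open>U\<^sub>i\<close> contain \<open>T\<^bsup>m i\<^esup> W\<close> for a single open set \<open>W\<close>. If
    \<open>W\<close> is small enough and \<open>x\<close>, \<open>T\<^sup>n x\<close> are both in it, then, as \<open>T\<^sup>n\<close> commutes with
    \<open>T\<^bsup>m i\<^esup>\<close>, every point \<open>T\<^bsup>m i\<^esup> x \<in> U\<^sub>i\<close> is close to its image under \<open>T\<^sup>n\<close>.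

  \<^item> Some \<open>T\<^sup>m\<close> maps all points into a set of diameter at most \<open>1/(k+1)\<close>
    (\<open>shrinks_near_collapse\<close>). This is density of the proximal tuples together with continuity.

  Since \<open>C\<^sub>N \<subseteq> C\<^sub>k\<close> for \<open>k \<ge> N\<close>, the return times chosen for the sets \<open>C\<^sub>k\<close> work for every
  \<open>C\<^sub>N\<close> and, along a subsequence, pointwise on the union; similarly for the collapsing times.
\<close>

section \<open>Cantor sets\<close>

text \<open>
  Continuity on the Cantor space is expressed through cylinders: the image of \<open>x\<close> is determined up to
  \<open>\<epsilon>\<close> by finitely many bits of \<open>x\<close>.
\<close>

definition cantor_embedding :: "((nat \<Rightarrow> bool) \<Rightarrow> 'a::metric_space) \<Rightarrow> bool" where
  "cantor_embedding f \<longleftrightarrow> inj f \<and>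
     (\<forall>x. \<forall>\<epsilon>>0. \<exists>k. \<forall>y. (\<forall>i<k. y i = x i) \<longrightarrow> dist (f y) (f x) < \<epsilon>)"

lemma cantor_embedding_local:
  assumes "cantor_embedding f" "\<epsilon> > 0"
  obtains k where "\<And>y. (\<forall>i<k. y i = x i) \<Longrightarrow> dist (f y) (f x) < \<epsilon>"
proof -
  have "\<exists>k. \<forall>y. (\<forall>i<k. y i = x i) \<longrightarrow> dist (f y) (f x) < \<epsilon>"
    using assms unfolding cantor_embedding_def by simp
  then show thesis
    using that by blast
qed

text \<open>
  A continuous injection of the compact Cantor space into a Hausdorff space is a homeomorphism onto its
  image, so only continuity has to be translated: the cylinders form a base of the product topology.
\<close>

lemma cantor_set_iff: "cantor_set C \<longleftrightarrow> (\<exists>f. cantor_embedding f \<and> range f = C)"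
proof -
  let ?S = "product_topology (\<lambda>_::nat. discrete_topology (UNIV :: bool set)) UNIV"
  have top: "topspace ?S = UNIV"
    by (simp add: PiE_UNIV_domain)
  show ?thesis
  proof
    assume "cantor_set C"
    then have "?S homeomorphic_space top_of_set C"
      unfolding cantor_set_def by (rule homeomorphic_space_sym[THEN iffD1])
    then obtain f where f: "homeomorphic_map ?S (top_of_set C) f"
      unfolding homeomorphic_space ..
    have inj: "inj f" and ran: "range f = C"
      using homeomorphic_imp_injective_map[OF f] homeomorphic_imp_surjective_map[OF f] top
      by simp_all
    have cont: "continuous_map ?S euclidean f"
      by (rule continuous_map_into_fulltopology[OF homeomorphic_imp_continuous_map[OF f]])
    have loc: "\<exists>k. \<forall>y. (\<forall>i<k. y i = x i) \<longrightarrow> dist (f y) (f x) < \<epsilon>" if "\<epsilon> > 0" for x \<epsilon>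
    proof -
      have "openin ?S {y \<in> topspace ?S. f y \<in> ball (f x) \<epsilon>}"
        by (rule openin_continuous_map_preimage[OF cont]) simp
      moreover have "x \<in> {y \<in> topspace ?S. f y \<in> ball (f x) \<epsilon>}"
        using that top by simp
      ultimately have "\<exists>U. finite {i \<in> UNIV. U i \<noteq> topspace (discrete_topology (UNIV :: bool set))} \<and>
          (\<forall>i\<in>UNIV. openin (discrete_topology UNIV) (U i)) \<and> x \<in> Pi\<^sub>E UNIV U \<and>
          Pi\<^sub>E UNIV U \<subseteq> {y \<in> topspace ?S. f y \<in> ball (f x) \<epsilon>}"
        unfolding openin_product_topology_alt by (rule bspec)
      then obtain U where U: "finite {i \<in> UNIV. U i \<noteq> topspace (discrete_topology (UNIV :: bool set))}"
        "x \<in> Pi\<^sub>E UNIV U" "Pi\<^sub>E UNIV U \<subseteq> {y \<in> topspace ?S. f y \<in> ball (f x) \<epsilon>}"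
        by (elim exE conjE)
      have "finite {i. U i \<noteq> UNIV}"
        using U(1) by simp
      then obtain k where k: "\<forall>i\<in>{i. U i \<noteq> UNIV}. i < k"
        unfolding finite_nat_set_iff_bounded by blast
      have "dist (f y) (f x) < \<epsilon>" if y: "\<forall>i<k. y i = x i" for y
      proof -
        have "y i \<in> U i" for i
          using k y U(2) by (cases "U i = UNIV") (auto simp: PiE_UNIV_domain)
        then have "y \<in> Pi\<^sub>E UNIV U"
          by (simp add: PiE_UNIV_domain)
        then show ?thesis
          using U(3) by (auto simp: dist_commute)
      qed
      then show ?thesis by blast
    qed
    have "cantor_embedding f"
      unfolding cantor_embedding_def by (intro conjI allI impI inj loc)
    then show "\<exists>f. cantor_embedding f \<and> range f = C"
      using ran by (intro exI conjI)
  next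
    assume "\<exists>f. cantor_embedding f \<and> range f = C"
    then obtain f where emb: "cantor_embedding f" and ran: "range f = C"
      by blast
    then have inj: "inj f"
      by (simp add: cantor_embedding_def)
    have "openin ?S {y \<in> topspace ?S. f y \<in> V}" if V: "open V" for V
    proof (subst openin_subopen, intro ballI)
      fix x assume x: "x \<in> {y \<in> topspace ?S. f y \<in> V}"
      then obtain \<epsilon> where \<epsilon>: "\<epsilon> > 0" "ball (f x) \<epsilon> \<subseteq> V"
        using V open_contains_ball by blast
      then obtain k where k: "\<And>y. (\<forall>i<k. y i = x i) \<Longrightarrow> dist (f y) (f x) < \<epsilon>"
        using cantor_embedding_local[OF emb, of \<epsilon> x] by blast
      let ?W = "Pi\<^sub>E UNIV (\<lambda>i. if i < k then {x i} else UNIV)"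
      have "{i. (if i < k then {x i} else UNIV) \<noteq> topspace (discrete_topology (UNIV :: bool set))}
              \<subseteq> {..<k}"
        by auto
      then have "openin ?S ?W"
        by (intro product_topology_basis) (auto intro: finite_subset)
      moreover have "x \<in> ?W"
        by (auto simp: PiE_UNIV_domain)
      moreover have "?W \<subseteq> {y \<in> topspace ?S. f y \<in> V}"
      proof
        fix y assume "y \<in> ?W"
        then have "\<forall>i<k. y i = x i"
          by (auto simp: PiE_UNIV_domain Pi_iff split: if_splits)
        then have "dist (f y) (f x) < \<epsilon>"
          by (rule k)
        then have "f y \<in> ball (f x) \<epsilon>"
          by (simp add: dist_commute)
        then show "y \<in> {y \<in> topspace ?S. f y \<in> V}"
          using \<epsilon>(2) top by blast
      qed
      ultimately show "\<exists>W. openin ?S W \<and> x \<in> W \<and> W \<subseteq> {y \<in> topspace ?S. f y \<in> V}"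
        by blast
    qed
    then have "continuous_map ?S euclidean f"
      by (simp add: continuous_map_def)
    then have cont: "continuous_map ?S (top_of_set C) f"
      using ran by (auto simp: continuous_map_in_subtopology)
    have "compact_space ?S"
      by (simp add: compact_space_product_topology compact_space_discrete_topology)
    moreover have "Hausdorff_space (top_of_set C)"
      by (simp add: Hausdorff_space_subtopology)
    ultimately have "homeomorphic_map ?S (top_of_set C) f"
      using cont inj ran top by (intro continuous_imp_homeomorphic_map) simp_all
    then show "cantor_set C"
      unfolding cantor_set_def
      by (rule homeomorphic_space_sym[THEN iffD1, OF homeomorphic_map_imp_homeomorphic_space])
  qed
qed

text \<open>
  The first bit selects one of the two sets and the remaining bits a point in it. Disjointness makes the
  resulting parametrization injective; it is continuous because each half of the Cantor space is clopen.
\<close>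

lemma cantor_set_disjoint_Un:
  assumes "cantor_set A" "cantor_set B" and disj: "A \<inter> B = {}"
  shows "cantor_set (A \<union> B)"
proof -
  obtain f g where f: "cantor_embedding f" "range f = A" and g: "cantor_embedding g" "range g = B"
    using assms(1,2) unfolding cantor_set_iff by blast
  define tl where "tl x = (\<lambda>i. x (Suc i))" for x :: "nat \<Rightarrow> bool"
  define h where "h x = (if x 0 then f (tl x) else g (tl x))" for x :: "nat \<Rightarrow> bool"
  have tl: "tl x i = x (Suc i)" for x i
    by (simp add: tl_def)
  have "inj h"
  proof (rule injI)
    fix x y assume eq: "h x = h y"
    have ne: "f u \<noteq> g v" "g v \<noteq> f u" for u v
      using disj f(2) g(2) by (metis disjoint_iff rangeI)+
    then have head: "x 0 = y 0"
      using eq unfolding h_def by (cases "x 0"; cases "y 0") simp_all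
    have inj: "inj f" "inj g"
      using f(1) g(1) by (auto simp: cantor_embedding_def)
    have tail: "tl x = tl y"
    proof (cases "y 0")
      case True
      then have "f (tl x) = f (tl y)"
        using eq head by (simp add: h_def)
      then show ?thesis
        by (rule injD[OF inj(1)])
    next
      case False
      then have "g (tl x) = g (tl y)"
        using eq head by (simp add: h_def)
      then show ?thesis
        by (rule injD[OF inj(2)])
    qed
    show "x = y"
    proof
      fix i show "x i = y i"
        using head fun_cong[OF tail] by (cases i) (auto simp: tl)
    qed
  qed
  moreover have "\<exists>k. \<forall>y. (\<forall>i<k. y i = x i) \<longrightarrow> dist (h y) (h x) < \<epsilon>" if \<epsilon>: "\<epsilon> > 0" for x \<epsilon>
  proof -
    obtain k where k: "\<And>y. (\<forall>i<k. y i = tl x i) \<Longrightarrow> dist (f y) (f (tl x)) < \<epsilon>"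
      using cantor_embedding_local[OF f(1) \<epsilon>, of "tl x"] by blast
    obtain l where l: "\<And>y. (\<forall>i<l. y i = tl x i) \<Longrightarrow> dist (g y) (g (tl x)) < \<epsilon>"
      using cantor_embedding_local[OF g(1) \<epsilon>, of "tl x"] by blast
    have "dist (h y) (h x) < \<epsilon>" if "\<forall>i<Suc (max k l). y i = x i" for y
      using that k[of "tl y"] l[of "tl y"] by (auto simp: h_def tl)
    then show ?thesis by blast
  qed
  moreover have "range h = A \<union> B"
  proof
    show "range h \<subseteq> A \<union> B"
      using f(2) g(2) by (auto simp: h_def)
    have "tl (case_nat b u) = u" for b u
      by (simp add: tl_def)
    then have "f u = h (case_nat True u)" "g u = h (case_nat False u)" for u
      by (simp_all add: h_def)
    then show "A \<union> B \<subseteq> range h"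
      using f(2) g(2) by auto
  qed
  ultimately have "cantor_embedding h \<and> range h = A \<union> B"
    unfolding cantor_embedding_def by simp
  then show ?thesis
    unfolding cantor_set_iff by blast
qed

text \<open>
  A bit sequence determines a decreasing sequence of compact cells, which has a common point. Two sequences
  are separated at the first bit where they differ, and the small diameters give continuity.
\<close>

lemma cantor_scheme:
  fixes G :: "bool list \<Rightarrow> 'a::metric_space set"
  assumes comp: "\<And>s. compact (G s)" and ne: "\<And>s. G s \<noteq> {}"
    and nest: "\<And>s b. G (s @ [b]) \<subseteq> G s"
    and disj: "\<And>s. G (s @ [True]) \<inter> G (s @ [False]) = {}"
    and small: "\<And>\<epsilon>. \<epsilon> > 0 \<Longrightarrow> \<exists>k. \<forall>s. length s = k \<longrightarrow> (\<forall>x\<in>G s. \<forall>y\<in>G s. dist x y < \<epsilon>)"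
  obtains C where "cantor_set C" "\<And>k. C \<subseteq> (\<Union>s\<in>{s. length s = k}. G s)"
proof -
  have step: "G (map x [0..<Suc k]) \<subseteq> G (map x [0..<k])" for x k
    using nest[of "map x [0..<k]" "x k"] by simp
  have "\<exists>p. \<forall>k. p \<in> G (map x [0..<k])" for x
  proof -
    have dec: "decseq (\<lambda>k. G (map x [0..<k]))"
      using step by (rule decseq_SucI)
    then have "G (map x [0..<k]) \<subseteq> G []" for k
      using decseqD[OF dec, of 0 k] by simp
    then have "closedin (top_of_set (G [])) (G (map x [0..<k]))" for k
      by (simp add: closed_subset compact_imp_closed comp)
    moreover have "compact_space (top_of_set (G []))"
      using comp by (simp add: compact_space_subtopology)
    ultimately have "(\<Inter>k. G (map x [0..<k])) \<noteq> {}"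
      using ne dec by (intro compact_space_imp_nest) auto
    then show ?thesis by blast
  qed
  then obtain f where f: "\<And>x k. f x \<in> G (map x [0..<k])"
    by metis
  have "inj f"
  proof (rule injI, rule ccontr)
    fix x y assume eq: "f x = f y" and "x \<noteq> y"
    then have ex: "\<exists>i. x i \<noteq> y i"
      by blast
    define i where "i = (LEAST i. x i \<noteq> y i)"
    have i: "x i \<noteq> y i"
      unfolding i_def using ex by (rule LeastI_ex)
    have "\<And>j. j < i \<Longrightarrow> x j = y j"
      unfolding i_def using not_less_Least by blast
    then have same: "map y [0..<i] = map x [0..<i]"
      by simp
    have "f x \<in> G (map x [0..<i] @ [x i])"
      using f[of x "Suc i"] by simp
    moreover have "f x \<in> G (map y [0..<i] @ [y i])"
      using f[of y "Suc i"] eq by simp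
    then have "f x \<in> G (map x [0..<i] @ [y i])"
      unfolding same .
    ultimately show False
      using disj[of "map x [0..<i]"] i by (cases "x i"; cases "y i") auto
  qed
  moreover have "\<exists>k. \<forall>y. (\<forall>i<k. y i = x i) \<longrightarrow> dist (f y) (f x) < \<epsilon>" if \<epsilon>: "\<epsilon> > 0" for x \<epsilon>
  proof -
    obtain k where k: "\<And>s u v. length s = k \<Longrightarrow> u \<in> G s \<Longrightarrow> v \<in> G s \<Longrightarrow> dist u v < \<epsilon>"
      using small[OF \<epsilon>] by blast
    have "dist (f y) (f x) < \<epsilon>" if "\<forall>i<k. y i = x i" for y
    proof -
      have same: "map y [0..<k] = map x [0..<k]"
        using that by simp
      have "f y \<in> G (map x [0..<k])"
        using f[of y k] unfolding same .
      then show ?thesis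
        using k[of "map x [0..<k]"] f[of x k] by simp
    qed
    then show ?thesis by blast
  qed
  ultimately have "cantor_set (range f)"
    unfolding cantor_set_iff cantor_embedding_def by blast
  moreover have "range f \<subseteq> (\<Union>s\<in>{s. length s = k}. G s)" for k
  proof
    fix p assume "p \<in> range f"
    then obtain x where "p = f x" ..
    then have "p \<in> G (map x [0..<k])" "map x [0..<k] \<in> {s. length s = k}"
      using f by simp_all
    then show "p \<in> (\<Union>s\<in>{s. length s = k}. G s)"
      by (rule UN_I[rotated])
  qed
  ultimately show thesis
    using that by blast
qed

section \<open>Fusion of cells in a perfect compact space\<close>

definition open_family :: "'a::metric_space set \<Rightarrow> 'i set \<Rightarrow> ('i \<Rightarrow> 'a set) \<Rightarrow> bool" where
  "open_family X I U \<longleftrightarrow> (\<forall>i\<in>I. openin (top_of_set X) (U i) \<and> U i \<noteq> {})"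

text \<open>
  The requirement \<open>P\<close> is imposed on the union of the shrunk sets, not on each set separately: one
  iterate of the map has to serve all cells of a stage.
\<close>

definition shrinks :: "'a::metric_space set \<Rightarrow> 'i set \<Rightarrow> ('a set \<Rightarrow> bool) \<Rightarrow> bool" where
  "shrinks X I P \<longleftrightarrow> (\<forall>U. open_family X I U \<longrightarrow>
     (\<exists>V. open_family X I V \<and> (\<forall>i\<in>I. V i \<subseteq> U i) \<and> P (\<Union>i\<in>I. V i)))"

lemma shrinksD:
  assumes "shrinks X I P" "open_family X I U"
  obtains V where "open_family X I V" "\<And>i. i \<in> I \<Longrightarrow> V i \<subseteq> U i" "P (\<Union>i\<in>I. V i)"
  using assms unfolding shrinks_def by blast

text \<open>
  The sets are shrunk for \<open>P\<close> and then again for \<open>Q\<close>; the second shrinking preserves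
  \<open>P\<close> because \<open>P\<close> passes to subsets.
\<close>

lemma shrinks_conj:
  assumes P: "shrinks X I P" and Q: "shrinks X I Q"
    and hered: "\<And>A B. A \<subseteq> B \<Longrightarrow> P B \<Longrightarrow> P A"
  shows "shrinks X I (\<lambda>A. P A \<and> Q A)"
  unfolding shrinks_def
proof (intro allI impI)
  fix U assume "open_family X I U"
  then obtain V where V: "open_family X I V" "\<And>i. i \<in> I \<Longrightarrow> V i \<subseteq> U i" "P (\<Union>i\<in>I. V i)"
    using P shrinksD by metis
  then obtain W where W: "open_family X I W" "\<And>i. i \<in> I \<Longrightarrow> W i \<subseteq> V i" "Q (\<Union>i\<in>I. W i)"
    using Q shrinksD by metis
  have "P (\<Union>i\<in>I. W i)"
    using W(2) V(3) by (intro hered[of "\<Union>i\<in>I. W i" "\<Union>i\<in>I. V i"] UN_mono) auto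
  then show "\<exists>V. open_family X I V \<and> (\<forall>i\<in>I. V i \<subseteq> U i) \<and> P (\<Union>i\<in>I. V i) \<and> Q (\<Union>i\<in>I. V i)"
    using V W by blast
qed

lemma distinct_representatives:
  assumes "finite I" "\<And>i. i \<in> I \<Longrightarrow> infinite (W i)"
  shows "\<exists>p. inj_on p I \<and> (\<forall>i\<in>I. p i \<in> W i)"
  using assms
proof (induction I rule: finite_induct)
  case (insert i I)
  then obtain p where p: "inj_on p I" "\<forall>i\<in>I. p i \<in> W i"
    by auto
  obtain q where q: "q \<in> W i" "q \<notin> p ` I"
    using insert by (metis finite_imageI finite_subset insertI1 subsetI)
  have "inj_on (p(i := q)) (insert i I)"
    using p(1) q(2) insert.hyps(2) by (auto simp: inj_on_def)
  moreover have "\<forall>j\<in>insert i I. (p(i := q)) j \<in> W j"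
    using p(2) q(1) by auto
  ultimately show ?case
    by blast
qed auto

lemma infinite_openin_perfect:
  fixes X :: "'a::metric_space set"
  assumes perfect: "\<not> (\<exists>x. x isolated_in X)"
    and U: "openin (top_of_set X) U" "U \<noteq> {}"
  shows "infinite U"
proof -
  obtain x where x: "x \<in> U" "x \<in> X"
    using U openin_imp_subset by blast
  then obtain e where "e > 0" "ball x e \<inter> X \<subseteq> U"
    using U(1) unfolding openin_contains_ball by blast
  moreover have "x islimpt X"
    using perfect x isolated_in_islimpt_iff by blast
  ultimately show ?thesis
    by (metis Int_commute infinite_super islimpt_eq_infinite_ball)
qed

text \<open>
  One refinement step. After the sets have been shrunk to satisfy \<open>P\<close>, they are infinite because \<open>X\<close>
  has no isolated points, so they contain distinct points; the cells are the traces on \<open>X\<close>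
  of closed balls of a sufficiently small common radius around these points.
\<close>

lemma separated_small_cells:
  assumes X: "compact X" and perfect: "\<not> (\<exists>x. x isolated_in X)"
    and I: "finite I" and W: "open_family X I W" and "\<epsilon> > 0"
    and P: "shrinks X I P" and hered: "\<And>A B. A \<subseteq> B \<Longrightarrow> P B \<Longrightarrow> P A"
  obtains E where
    "\<And>i. i \<in> I \<Longrightarrow> compact (E i) \<and> E i \<subseteq> W i \<and> (\<exists>U. openin (top_of_set X) U \<and> U \<noteq> {} \<and> U \<subseteq> E i)"
    "\<And>i j. i \<in> I \<Longrightarrow> j \<in> I \<Longrightarrow> i \<noteq> j \<Longrightarrow> E i \<inter> E j = {}"
    "\<And>i x y. i \<in> I \<Longrightarrow> x \<in> E i \<Longrightarrow> y \<in> E i \<Longrightarrow> dist x y < \<epsilon>"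
    "P (\<Union>i\<in>I. E i)"
proof -
  obtain V where V: "open_family X I V" "\<And>i. i \<in> I \<Longrightarrow> V i \<subseteq> W i" "P (\<Union>i\<in>I. V i)"
    using P W shrinksD by metis
  have "infinite (V i)" if "i \<in> I" for i
    using V(1) that infinite_openin_perfect[OF perfect] unfolding open_family_def by blast
  then obtain p where p: "inj_on p I" "\<forall>i\<in>I. p i \<in> V i"
    using distinct_representatives[OF I] by blast
  have "\<exists>e>0. X \<inter> ball (p i) e \<subseteq> V i" if "i \<in> I" for i
    using V(1) p(2) that unfolding open_family_def openin_contains_ball by (metis Int_commute)
  then obtain e where e: "\<And>i. i \<in> I \<Longrightarrow> e i > 0 \<and> X \<inter> ball (p i) (e i) \<subseteq> V i"
    by metis
  define S where "S = insert \<epsilon> (e ` I \<union> (\<lambda>(i, j). dist (p i) (p j)) ` {(i, j) \<in> I \<times> I. i \<noteq> j})"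
  have S: "finite S" "S \<noteq> {}"
    using I by (auto simp: S_def intro: finite_subset[of _ "I \<times> I"])
  have "\<forall>d\<in>S. d > 0"
    using e p(1) \<open>\<epsilon> > 0\<close> by (auto simp: S_def inj_on_def)
  \<comment> \<open>A third of every relevant distance: \<open>2 * r\<close> then stays below \<open>\<epsilon>\<close> and below all mutual distances.\<close>
  define r where "r = Min S / 3"
  have r: "r > 0" "\<And>d. d \<in> S \<Longrightarrow> 3 * r \<le> d"
    using S \<open>\<forall>d\<in>S. d > 0\<close> by (simp_all add: r_def)
  define E where "E i = X \<inter> cball (p i) r" for i
  have EV: "E i \<subseteq> V i" if "i \<in> I" for i
  proof -
    have "3 * r \<le> e i"
      using that by (intro r(2)) (simp add: S_def)
    then have "r < e i"
      using r(1) by linarith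
    then show ?thesis
      using e[OF that] by (auto simp: E_def)
  qed
  show thesis
  proof (rule that[of E])
    fix i assume i: "i \<in> I"
    have "compact (E i)"
      unfolding E_def using X by (intro compact_Int_closed) auto
    moreover have "E i \<subseteq> W i"
      using EV V(2) i by blast
    moreover have "openin (top_of_set X) (X \<inter> ball (p i) r)"
      by (simp add: openin_open_Int)
    moreover have "p i \<in> X \<inter> ball (p i) r"
      using V(1) p(2) i r(1) openin_imp_subset unfolding open_family_def by fastforce
    moreover have "X \<inter> ball (p i) r \<subseteq> E i"
      by (auto simp: E_def)
    ultimately show "compact (E i) \<and> E i \<subseteq> W i \<and>
        (\<exists>U. openin (top_of_set X) U \<and> U \<noteq> {} \<and> U \<subseteq> E i)"
      by blast
  next
    fix i j assume ij: "i \<in> I" "j \<in> I" "i \<noteq> j"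
    then have d: "3 * r \<le> dist (p i) (p j)"
      by (intro r(2)) (auto simp: S_def)
    show "E i \<inter> E j = {}"
    proof (rule ccontr)
      assume "E i \<inter> E j \<noteq> {}"
      then obtain x where "dist (p i) x \<le> r" "dist (p j) x \<le> r"
        by (auto simp: E_def)
      then show False
        using d r(1) dist_triangle2[of "p i" "p j" x] by linarith
    qed
  next
    fix i x y assume "i \<in> I" "x \<in> E i" "y \<in> E i"
    then have "dist (p i) x \<le> r" "dist (p i) y \<le> r"
      by (auto simp: E_def)
    moreover have "3 * r \<le> \<epsilon>"
      by (intro r(2)) (simp add: S_def)
    ultimately show "dist x y < \<epsilon>"
      using r(1) dist_triangle3[of x y "p i"] by linarith
  next
    show "P (\<Union>i\<in>I. E i)"
      using EV by (intro hered[OF _ V(3)] UN_mono) auto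
  qed
qed

text \<open>
  A compact metric space is totally bounded, so finite \<open>1/(m+1)\<close>-nets yield a countable dense set, and every
  nonempty open set contains one of the balls of radius \<open>1/(m+1)\<close> around its points.
\<close>

lemma countable_pi_base:
  fixes X :: "'a::metric_space set"
  assumes X: "compact X" "X \<noteq> {}"
  obtains B :: "nat \<Rightarrow> 'a set" where "\<And>n. openin (top_of_set X) (B n) \<and> B n \<noteq> {}"
    "\<And>U. openin (top_of_set X) U \<Longrightarrow> U \<noteq> {} \<Longrightarrow> \<exists>n. B n \<subseteq> U"
proof -
  have "\<forall>e>0. \<exists>k. finite k \<and> k \<subseteq> X \<and> X \<subseteq> (\<Union>x\<in>k. ball x e)"
    using X(1) by (intro seq_compact_imp_totally_bounded) (simp add: compact_eq_seq_compact_metric)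
  then have "\<forall>m::nat. \<exists>k. finite k \<and> k \<subseteq> X \<and> X \<subseteq> (\<Union>x\<in>k. ball x (inverse (Suc m)))"
    by simp
  then obtain k where k: "\<And>m::nat. finite (k m) \<and> k m \<subseteq> X \<and> X \<subseteq> (\<Union>x\<in>k m. ball x (inverse (Suc m)))"
    by metis
  define D where "D = (\<Union>m. k m)"
  have "countable (k m)" for m
    using k by (simp add: countable_finite)
  then have D: "countable D" "D \<subseteq> X"
    using k by (auto simp: D_def)
  have "k 0 \<noteq> {}"
    using k[of 0] X(2) by force
  then have "D \<noteq> {}"
    by (auto simp: D_def)
  define B where "B n = X \<inter> ball (from_nat_into D (fst (prod_decode n))) (inverse (Suc (snd (prod_decode n))))" for n
  show thesis
  proof (rule that[of B])
    fix n
    have "from_nat_into D (fst (prod_decode n)) \<in> B n"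
      using from_nat_into[OF \<open>D \<noteq> {}\<close>, of "fst (prod_decode n)"] D(2) by (auto simp: B_def)
    then show "openin (top_of_set X) (B n) \<and> B n \<noteq> {}"
      by (auto simp: B_def openin_open_Int)
  next
    fix U assume U: "openin (top_of_set X) U" "U \<noteq> {}"
    then obtain x e where xe: "x \<in> U" "x \<in> X" "e > 0" "ball x e \<inter> X \<subseteq> U"
      unfolding openin_contains_ball by blast
    obtain m where m: "inverse (Suc m) < e / 2"
      using reals_Archimedean[of "e / 2"] xe(3) by auto
    obtain d where d: "d \<in> k m" "dist d x < inverse (Suc m)"
      using k[of m] xe(2) by fastforce
    have "d \<in> D"
      using d(1) by (auto simp: D_def)
    then obtain i where i: "from_nat_into D i = d"
      using D(1) from_nat_into_surj by metis
    have "ball d (inverse (Suc m)) \<subseteq> ball x e"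
    proof
      fix y assume "y \<in> ball d (inverse (Suc m))"
      then show "y \<in> ball x e"
        using d(2) m dist_triangle3[of x y d] by (auto simp: dist_commute)
    qed
    then have "B (prod_encode (i, m)) \<subseteq> U"
      using xe(4) i by (auto simp: B_def)
    then show "\<exists>n. B n \<subseteq> U" ..
  qed
qed

text \<open>
  The fusion argument. The zero string is exempt from nesting, so that at each stage it can start a new
  Cantor set inside a prescribed open set; every other string refines the cell of its parent. The
  index type \<open>bool list\<close> in the shrinking hypothesis is the type of labels of cells.
\<close>

lemma increasing_cantor_sets:
  fixes X :: "'a::metric_space set" and P :: "nat \<Rightarrow> 'a set \<Rightarrow> bool"
  assumes X: "compact X" "X \<noteq> {}" and perfect: "\<not> (\<exists>x. x isolated_in X)"
    and hered: "\<And>k A B. A \<subseteq> B \<Longrightarrow> P k B \<Longrightarrow> P k A"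
    and shr: "\<And>k (I :: bool list set). finite I \<Longrightarrow> shrinks X I (P k)"
  shows "\<exists>C. (\<forall>N\<ge>1. cantor_set (C N)) \<and> (\<forall>N. C N \<subseteq> X) \<and> (\<forall>N. C N \<subseteq> C (Suc N)) \<and>
    dense_in (top_of_set X) (\<Union>N\<in>{1..}. C N) \<and> (\<forall>N\<ge>1. P N (C N))"
proof -
  obtain B :: "nat \<Rightarrow> 'a set" where B: "\<And>n. openin (top_of_set X) (B n) \<and> B n \<noteq> {}"
    and B_base: "\<And>U. openin (top_of_set X) U \<Longrightarrow> U \<noteq> {} \<Longrightarrow> \<exists>n. B n \<subseteq> U"
    using countable_pi_base[OF X] by blast
  let ?zero = "\<lambda>n. replicate n False"
  let ?cell = "\<lambda>A. compact A \<and> A \<subseteq> X \<and> (\<exists>U. openin (top_of_set X) U \<and> U \<noteq> {} \<and> U \<subseteq> A)"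
  \<comment> \<open>A stage assigns a cell to each string; at stage \<open>n\<close> only strings of length \<open>n\<close> are relevant.\<close>
  define good where "good n F \<longleftrightarrow> (\<forall>s. length s = n \<longrightarrow> ?cell (F s))" for n and F :: "bool list \<Rightarrow> 'a set"
  define succ where "succ n F F' \<longleftrightarrow>
      (\<forall>s b. length s = n \<longrightarrow> s \<noteq> ?zero n \<longrightarrow> F' (s @ [b]) \<subseteq> F s) \<and>
      (\<forall>b. F' (?zero n @ [b]) \<subseteq> B n) \<and>
      (\<forall>s t. length s = Suc n \<longrightarrow> length t = Suc n \<longrightarrow> s \<noteq> t \<longrightarrow> F' s \<inter> F' t = {}) \<and>
      (\<forall>s. length s = Suc n \<longrightarrow> (\<forall>x\<in>F' s. \<forall>y\<in>F' s. dist x y < inverse (Suc n))) \<and>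
      P (Suc n) (\<Union>s\<in>{s. length s = Suc n}. F' s)" for n and F F' :: "bool list \<Rightarrow> 'a set"
  have "\<exists>F. \<forall>n. good n (F n) \<and> succ n (F n) (F (Suc n))"
  proof (rule dependent_nat_choice)
    show "\<exists>F. good 0 F"
      using X by (intro exI[of _ "\<lambda>_. X"]) (auto simp: good_def)
  next
    fix F n assume F: "good n F"
    let ?I = "{s :: bool list. length s = Suc n}"
    have "\<forall>s. length s = n \<longrightarrow> (\<exists>U. openin (top_of_set X) U \<and> U \<noteq> {} \<and> U \<subseteq> F s)"
      using F unfolding good_def by blast
    then obtain O' where O': "\<And>s. length s = n \<Longrightarrow> openin (top_of_set X) (O' s) \<and> O' s \<noteq> {} \<and> O' s \<subseteq> F s"
      by metis
    define W where "W t = (if butlast t = ?zero n then B n else O' (butlast t))" for t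
    have W: "open_family X ?I W"
      using B O' by (auto simp: open_family_def W_def)
    have fin: "finite ?I"
      using finite_lists_length_eq[of "UNIV :: bool set" "Suc n"] by simp
    obtain E where E: "\<And>t. t \<in> ?I \<Longrightarrow> compact (E t) \<and> E t \<subseteq> W t \<and>
          (\<exists>U. openin (top_of_set X) U \<and> U \<noteq> {} \<and> U \<subseteq> E t)"
      "\<And>s t. s \<in> ?I \<Longrightarrow> t \<in> ?I \<Longrightarrow> s \<noteq> t \<Longrightarrow> E s \<inter> E t = {}"
      "\<And>t x y. t \<in> ?I \<Longrightarrow> x \<in> E t \<Longrightarrow> y \<in> E t \<Longrightarrow> dist x y < inverse (Suc n)"
      "P (Suc n) (\<Union>t\<in>?I. E t)"
    proof (rule separated_small_cells[OF X(1) perfect fin W _ shr[OF fin], of "inverse (real (Suc n))" "Suc n"])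
    qed (use hered in auto)
    have "E t \<subseteq> X" if "t \<in> ?I" for t
      using E(1)[OF that] W that openin_imp_subset unfolding open_family_def by blast
    then have "good (Suc n) E"
      using E(1) by (auto simp: good_def)
    moreover have "E (s @ [b]) \<subseteq> F s" if "length s = n" "s \<noteq> ?zero n" for s b
      using E(1)[of "s @ [b]"] O'[OF that(1)] that by (auto simp: W_def)
    moreover have "E (?zero n @ [b]) \<subseteq> B n" for b
      using E(1)[of "?zero n @ [b]"] by (auto simp: W_def)
    ultimately show "\<exists>F'. good (Suc n) F' \<and> succ n F F'"
      using E(2-4) by (intro exI[of _ E]) (auto simp: succ_def)
  qed
  then obtain F where good: "\<And>n. good n (F n)" and succ: "\<And>n. succ n (F n) (F (Suc n))"
    by blast
  \<comment> \<open>The stages merge into one family, since the length of a string tells its stage.\<close>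
  define E where "E s = F (length s) s" for s
  have cell: "?cell (E s)" for s
    using good unfolding good_def E_def by blast
  have nest: "E (s @ [b]) \<subseteq> E s" if "s \<noteq> ?zero (length s)" for s b
    using succ[of "length s"] that by (simp add: succ_def E_def)
  have start: "E (?zero n @ [b]) \<subseteq> B n" for n b
    using succ[of n] by (simp add: succ_def E_def)
  have disj: "E s \<inter> E t = {}" if len: "length s = length t" "s \<noteq> t" for s t
  proof -
    obtain n where "length s = Suc n"
      using len by (cases s; cases t) auto
    then show ?thesis
      using succ[of n] len by (simp add: succ_def E_def)
  qed
  have small: "dist x y < inverse (Suc n)" if "length s = Suc n" "x \<in> E s" "y \<in> E s" for n s x y
    using succ[of n] that by (simp add: succ_def E_def)
  have PE: "P (Suc n) (\<Union>s\<in>{s. length s = Suc n}. E s)" for n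
  proof -
    have "(\<Union>s\<in>{s. length s = Suc n}. E s) = (\<Union>s\<in>{s. length s = Suc n}. F (Suc n) s)"
      by (simp add: E_def)
    then show ?thesis
      using succ[of n] by (simp add: succ_def)
  qed
  \<comment> \<open>Extensions of \<open>0\<^sup>j1\<close> are never zero strings, so the cells below \<open>0\<^sup>j1\<close> form a Cantor scheme.\<close>
  have "\<exists>D. cantor_set D \<and> (\<forall>k. D \<subseteq> (\<Union>s\<in>{s. length s = k}. E (?zero j @ True # s)))" for j
  proof -
    have not_zero: "?zero i @ True # s \<noteq> ?zero n" for i s n
    proof
      assume eq: "?zero i @ True # s = ?zero n"
      have "True \<in> set (?zero n)"
        unfolding eq[symmetric] by simp
      then show False
        by simp
    qed
    define G where "G s = E (?zero j @ True # s)" for s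
    have comp: "compact (G s)" and ne: "G s \<noteq> {}" for s
      using cell[of "?zero j @ True # s"] by (auto simp: G_def)
    have G_nest: "G (s @ [b]) \<subseteq> G s" for s b
      using nest[OF not_zero, of j s b] by (simp add: G_def)
    have G_disj: "G (s @ [True]) \<inter> G (s @ [False]) = {}" for s
      unfolding G_def by (rule disj) simp_all
    have G_small: "\<exists>k. \<forall>s. length s = k \<longrightarrow> (\<forall>x\<in>G s. \<forall>y\<in>G s. dist x y < \<epsilon>)" if "\<epsilon> > 0" for \<epsilon>
    proof -
      obtain k where k: "inverse (Suc k) < \<epsilon>"
        using reals_Archimedean \<open>\<epsilon> > 0\<close> by blast
      have "dist x y < \<epsilon>" if "length s = k" "x \<in> G s" "y \<in> G s" for s x y
      proof -
        have "length (?zero j @ True # s) = Suc (j + k)"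
          using that(1) by simp
        then have "dist x y < inverse (real (Suc (j + k)))"
          using that(2,3) unfolding G_def by (rule small)
        also have "\<dots> \<le> inverse (real (Suc k))"
          by (intro le_imp_inverse_le) auto
        finally show ?thesis
          using k by simp
      qed
      then show ?thesis
        by blast
    qed
    obtain D where "cantor_set D" "\<And>k. D \<subseteq> (\<Union>s\<in>{s. length s = k}. G s)"
      using cantor_scheme[OF comp ne G_nest G_disj G_small] by blast
    then show ?thesis
      unfolding G_def by blast
  qed
  then obtain D where D: "\<And>j. cantor_set (D j)"
    and D_cover: "\<And>j k. D j \<subseteq> (\<Union>s\<in>{s. length s = k}. E (?zero j @ True # s))"
    by metis
  have D_start: "D j \<subseteq> E (?zero j @ [True])" for j
    using D_cover[of j 0] by simp
  have D_ne: "D j \<noteq> {}" for j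
    using D[of j] unfolding cantor_set_iff by blast
  have D_disj: "D i \<inter> D j = {}" if "i < j" for i j
  proof -
    \<comment> \<open>Both strings have length \<open>j + 1\<close> and they differ at position \<open>i\<close>.\<close>
    have "E (?zero i @ True # s) \<inter> E (?zero j @ [True]) = {}" if "length s = j - i" for s
    proof (rule disj)
      show "length (?zero i @ True # s) = length (?zero j @ [True])"
        using that \<open>i < j\<close> by simp
      have "(?zero i @ True # s) ! i \<noteq> (?zero j @ [True]) ! i"
        using \<open>i < j\<close> by (simp add: nth_append)
      then show "?zero i @ True # s \<noteq> ?zero j @ [True]"
        by metis
    qed
    then show ?thesis
      using D_cover[of i "j - i"] D_start[of j] by blast
  qed
  define C where "C N = (\<Union>j<N. D j)" for N
  have C_Suc: "C (Suc N) = C N \<union> D N" for N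
    by (auto simp: C_def lessThan_Suc)
  show ?thesis
  proof (intro exI[of _ C] conjI allI impI)
    show "cantor_set (C N)" if "N \<ge> 1" for N
      using that
    proof (induction N rule: dec_induct)
      case base
      show ?case
        using D[of 0] by (simp add: C_def lessThan_Suc)
    next
      case (step N)
      have "C N \<inter> D N = {}"
        using D_disj by (auto simp: C_def)
      then show ?case
        unfolding C_Suc using step D by (intro cantor_set_disjoint_Un)
    qed
    show CX: "C N \<subseteq> X" for N
      using D_start cell unfolding C_def by blast
    show "C N \<subseteq> C (Suc N)" for N
      unfolding C_Suc by blast
    show "dense_in (top_of_set X) (\<Union>N\<in>{1..}. C N)"
      unfolding dense_in_def dense_intersects_open
    proof (intro conjI allI impI)
      show "(\<Union>N\<in>{1..}. C N) \<subseteq> topspace (top_of_set X)"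
        using CX by auto
      fix U assume "openin (top_of_set X) U \<and> U \<noteq> {}"
      then obtain n where n: "B n \<subseteq> U"
        using B_base by blast
      have "D n \<subseteq> B n"
        using D_start start by blast
      moreover have "D n \<subseteq> (\<Union>N\<in>{1..}. C N)"
        unfolding C_def by (auto intro!: bexI[of _ "Suc n"])
      ultimately show "(\<Union>N\<in>{1..}. C N) \<inter> U \<noteq> {}"
        using n D_ne[of n] by blast
    qed
    show "P N (C N)" if "N \<ge> 1" for N
    proof -
      obtain n where n: "N = Suc n"
        using \<open>N \<ge> 1\<close> by (cases N) auto
      have "D j \<subseteq> (\<Union>s\<in>{s. length s = N}. E s)" if "j < N" for j
      proof -
        have "?zero j @ True # s \<in> {s. length s = N}" if "length s = n - j" for s
          using that \<open>j < N\<close> n by simp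
        then show ?thesis
          using D_cover[of j "n - j"] by blast
      qed
      then have "C N \<subseteq> (\<Union>s\<in>{s. length s = N}. E s)"
        unfolding C_def by blast
      then show ?thesis
        using hered PE[of n] n by blast
    qed
  qed
qed

section \<open>Simultaneous return and simultaneous collapse\<close>

text \<open>
  The bound \<open>n \<ge> k\<close> forces the return times to tend to infinity along a sequence of stages.
\<close>

definition near_return :: "('a::metric_space \<Rightarrow> 'a) \<Rightarrow> nat \<Rightarrow> 'a set \<Rightarrow> bool" where
  "near_return T k A \<longleftrightarrow> (\<exists>n\<ge>k. \<forall>x\<in>A. dist ((T ^^ n) x) x < inverse (Suc k))"

definition near_collapse :: "('a::metric_space \<Rightarrow> 'a) \<Rightarrow> nat \<Rightarrow> 'a set \<Rightarrow> bool" where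
  "near_collapse T k A \<longleftrightarrow> (\<exists>m. \<forall>x\<in>A. \<forall>y\<in>A. dist ((T ^^ m) x) ((T ^^ m) y) < inverse (Suc k))"

lemma near_return_subset: "A \<subseteq> B \<Longrightarrow> near_return T k B \<Longrightarrow> near_return T k A"
  unfolding near_return_def by (meson subsetD)

lemma near_collapse_subset: "A \<subseteq> B \<Longrightarrow> near_collapse T k B \<Longrightarrow> near_collapse T k A"
  unfolding near_collapse_def by (meson subsetD)

lemma dynamical_system_funpow:
  assumes "dynamical_system X T"
  shows "continuous_on X (T ^^ n)" "(T ^^ n) ` X = X"
proof -
  have "continuous_on X (T ^^ n) \<and> (T ^^ n) ` X = X"
  proof (induction n)
    case (Suc n)
    then have "continuous_on X (T \<circ> T ^^ n)"
      using assms by (intro continuous_on_compose) (auto simp: dynamical_system_def)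
    moreover have "(T \<circ> T ^^ n) ` X = X"
      using Suc assms by (metis image_comp dynamical_system_def)
    ultimately show ?case
      by simp
  qed simp
  then show "continuous_on X (T ^^ n)" "(T ^^ n) ` X = X"
    by auto
qed

lemma openin_funpow_vimage:
  assumes "dynamical_system X T" "openin (top_of_set X) V"
  shows "openin (top_of_set X) (X \<inter> (T ^^ n) -` V)"
  using dynamical_system_funpow[OF assms(1), of n] assms(2)
  by (intro continuous_openin_preimage[where T = X]) auto

lemma openin_ball_vimage:
  assumes "continuous_on X g"
  shows "openin (top_of_set X) {x \<in> X. dist (g x) q < \<epsilon>}"
proof -
  have "continuous_on X (\<lambda>x. dist (g x) q)"
    using assms by (intro continuous_intros)
  then have "openin (top_of_set X) (X \<inter> (\<lambda>x. dist (g x) q) -` {..<\<epsilon>})"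
    by (rule continuous_openin_preimage_gen) simp
  also have "X \<inter> (\<lambda>x. dist (g x) q) -` {..<\<epsilon>} = {x \<in> X. dist (g x) q < \<epsilon>}"
    by auto
  finally show ?thesis .
qed

text \<open>
  Transitivity is applied to \<open>U\<close> and the preimage of \<open>V\<close> under \<open>T\<^sup>N\<close>, which is nonempty
  because \<open>T\<close> is surjective; this delays the hitting time by \<open>N\<close>.
\<close>

lemma transitive_late_hit:
  assumes ds: "dynamical_system X T" and tt: "topologically_transitive X T"
    and U: "openin (top_of_set X) U" "U \<noteq> {}" and V: "openin (top_of_set X) V" "V \<noteq> {}"
  shows "\<exists>n\<ge>N. \<exists>x\<in>U. (T ^^ n) x \<in> V"
proof -
  let ?V = "X \<inter> (T ^^ N) -` V"
  have "openin (top_of_set X) ?V"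
    by (rule openin_funpow_vimage[OF ds V(1)])
  moreover have "?V \<noteq> {}"
  proof -
    obtain v where "v \<in> V" "v \<in> X"
      using V openin_imp_subset by blast
    then obtain u where "u \<in> X" "v = (T ^^ N) u"
      using dynamical_system_funpow(2)[OF ds, of N] by blast
    then show ?thesis
      using \<open>v \<in> V\<close> by blast
  qed
  ultimately obtain n x where "x \<in> U" "(T ^^ n) x \<in> ?V"
    using tt U unfolding topologically_transitive_def by blast
  then have "(T ^^ (N + n)) x \<in> V"
    by (simp add: funpow_add)
  then show ?thesis
    using \<open>x \<in> U\<close> le_add1 by blast
qed

text \<open>
  The set \<open>W\<close> is cut down once for each index: transitivity leads some point of the current \<open>W\<close>
  into the next \<open>U i\<close>, and continuity keeps a neighbourhood of it. This plays the part of a point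
  with dense orbit.
\<close>

lemma common_itinerary:
  assumes ds: "dynamical_system X T" and tt: "topologically_transitive X T"
    and "finite I" "open_family X I U"
  shows "\<exists>W m. openin (top_of_set X) W \<and> W \<noteq> {} \<and> (\<forall>i\<in>I. \<forall>x\<in>W. (T ^^ m i) x \<in> U i)"
  using assms(3,4)
proof (induction I rule: finite_induct)
  case empty
  have "openin (top_of_set X) X \<and> X \<noteq> {}"
    using ds by (simp add: dynamical_system_def)
  then show ?case by blast
next
  case (insert i I)
  then obtain W m where W: "openin (top_of_set X) W" "W \<noteq> {}" "\<forall>i\<in>I. \<forall>x\<in>W. (T ^^ m i) x \<in> U i"
    by (auto simp: open_family_def)
  have Ui: "openin (top_of_set X) (U i)" "U i \<noteq> {}"
    using insert.prems by (auto simp: open_family_def)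
  obtain n x where nx: "x \<in> W" "(T ^^ n) x \<in> U i"
    using transitive_late_hit[OF ds tt W(1,2) Ui] by blast
  let ?W = "W \<inter> (X \<inter> (T ^^ n) -` U i)"
  have "openin (top_of_set X) ?W"
    using W(1) openin_funpow_vimage[OF ds Ui(1)] by (rule openin_Int)
  moreover have "x \<in> ?W"
    using nx W(1) openin_imp_subset by blast
  moreover have "\<forall>j\<in>insert i I. \<forall>x\<in>?W. (T ^^ (m(i := n)) j) x \<in> U j"
    using W(3) insert.hyps by auto
  ultimately show ?case by blast
qed

text \<open>
  Commuting iterates let one return serve all the sets. If \<open>x\<close> and \<open>T\<^sup>n x\<close> lie in a set
  on which every \<open>T\<^bsup>m i\<^esup>\<close> varies by less than \<open>\<epsilon>\<close>, then \<open>T\<^sup>n\<close> moves each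
  \<open>T\<^bsup>m i\<^esup> x\<close> by less than \<open>\<epsilon>\<close>, and by continuity also the nearby points of \<open>U i\<close>.
\<close>

lemma shrinks_near_return:
  assumes ds: "dynamical_system X T" and tt: "topologically_transitive X T" and I: "finite I"
  shows "shrinks X I (near_return T k)"
  unfolding shrinks_def
proof (intro allI impI)
  fix U assume U: "open_family X I U"
  define \<epsilon> where "\<epsilon> = inverse (real (Suc k))"
  have "\<epsilon> > 0"
    by (simp add: \<epsilon>_def)
  obtain W m where W: "openin (top_of_set X) W" "W \<noteq> {}" "\<And>i x. i \<in> I \<Longrightarrow> x \<in> W \<Longrightarrow> (T ^^ m i) x \<in> U i"
    using common_itinerary[OF ds tt I U] by blast
  obtain w where w: "w \<in> W" "w \<in> X"
    using W(1,2) openin_imp_subset by blast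
  \<comment> \<open>Shrinking around \<open>w\<close> with half of \<open>\<epsilon>\<close> makes the image of \<open>W'\<close> under each itinerary iterate smaller than \<open>\<epsilon>\<close>.\<close>
  define W' where "W' = W \<inter> (X \<inter> (\<Inter>i\<in>I. {x \<in> X. dist ((T ^^ m i) x) ((T ^^ m i) w) < \<epsilon> / 2}))"
  have "openin (top_of_set X) (X \<inter> (\<Inter>i\<in>I. {x \<in> X. dist ((T ^^ m i) x) ((T ^^ m i) w) < \<epsilon> / 2}))"
  proof (cases "I = {}")
    case False
    then have "openin (top_of_set X) (\<Inter>i\<in>I. {x \<in> X. dist ((T ^^ m i) x) ((T ^^ m i) w) < \<epsilon> / 2})"
      using I dynamical_system_funpow(1)[OF ds] by (intro openin_INT2 openin_ball_vimage) auto
    then show ?thesis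
      by (rule openin_Int[OF openin_subtopology_self])
  qed simp
  then have W'_open: "openin (top_of_set X) W'"
    unfolding W'_def by (rule openin_Int[OF W(1)])
  have W'_ne: "W' \<noteq> {}"
    using w \<open>\<epsilon> > 0\<close> by (auto simp: W'_def)
  obtain n x where n: "n \<ge> k" and x: "x \<in> W'" "(T ^^ n) x \<in> W'"
    using transitive_late_hit[OF ds tt W'_open W'_ne W'_open W'_ne, of k] by blast
  define V where "V i = U i \<inter> {y \<in> X. dist ((T ^^ n) y) y < \<epsilon>}" for i
  have "openin (top_of_set X) (V i) \<and> V i \<noteq> {}" if i: "i \<in> I" for i
  proof -
    have "continuous_on X (\<lambda>y. dist ((T ^^ n) y) y)"
      using dynamical_system_funpow(1)[OF ds] by (intro continuous_intros)
    then have "openin (top_of_set X) (X \<inter> (\<lambda>y. dist ((T ^^ n) y) y) -` {..<\<epsilon>})"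
      by (rule continuous_openin_preimage_gen) simp
    moreover have "X \<inter> (\<lambda>y. dist ((T ^^ n) y) y) -` {..<\<epsilon>} = {y \<in> X. dist ((T ^^ n) y) y < \<epsilon>}"
      by auto
    ultimately have "openin (top_of_set X) (V i)"
      using U i unfolding V_def open_family_def by auto
    moreover have "(T ^^ m i) x \<in> V i"
    proof -
      have "(T ^^ m i) x \<in> U i"
        using W(3) i x(1) by (auto simp: W'_def)
      moreover have "U i \<subseteq> X"
        using U i openin_imp_subset unfolding open_family_def by blast
      moreover have "(T ^^ n) ((T ^^ m i) x) = (T ^^ m i) ((T ^^ n) x)"
        by (metis add.commute comp_apply funpow_add)
      moreover have "dist ((T ^^ m i) x) ((T ^^ m i) w) < \<epsilon> / 2"
        "dist ((T ^^ m i) ((T ^^ n) x)) ((T ^^ m i) w) < \<epsilon> / 2"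
        using x i by (auto simp: W'_def)
      then have "dist ((T ^^ m i) ((T ^^ n) x)) ((T ^^ m i) x) < \<epsilon>"
        using dist_triangle_half_l by blast
      ultimately show ?thesis
        by (auto simp: V_def)
    qed
    ultimately show ?thesis by blast
  qed
  moreover have "near_return T k (\<Union>i\<in>I. V i)"
    using n by (auto simp: near_return_def V_def \<epsilon>_def)
  moreover have "\<forall>i\<in>I. V i \<subseteq> U i"
    by (auto simp: V_def)
  ultimately show "\<exists>V. open_family X I V \<and> (\<forall>i\<in>I. V i \<subseteq> U i) \<and> near_return T k (\<Union>i\<in>I. V i)"
    unfolding open_family_def by blast
qed

text \<open>
  The product of the given open sets is a nonempty open set in a power of \<open>X\<close>, so it contains a
  proximal tuple; the iterate that contracts this tuple contracts small neighbourhoods of its entries too.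
\<close>

lemma shrinks_near_collapse:
  assumes ds: "dynamical_system X T"
    and dense: "\<And>n. n \<ge> 1 \<Longrightarrow> dense_in (power_space X n) (Prox X T n)" and I: "finite I"
  shows "shrinks X I (near_collapse T k)"
  unfolding shrinks_def
proof (intro allI impI)
  fix U assume U: "open_family X I U"
  define \<epsilon> where "\<epsilon> = inverse (real (Suc k))"
  have "\<epsilon> > 0"
    by (simp add: \<epsilon>_def)
  show "\<exists>V. open_family X I V \<and> (\<forall>i\<in>I. V i \<subseteq> U i) \<and> near_collapse T k (\<Union>i\<in>I. V i)"
  proof (cases "I = {}")
    case True
    then show ?thesis
      using U by (auto simp: near_collapse_def)
  next
    case False
    let ?n = "card I"
    have n: "?n \<ge> 1"
      using False I by (simp add: Suc_le_eq card_gt_0_iff)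
    obtain h where h: "bij_betw h {1..?n} I"
      using I ex_bij_betw_nat_finite_1 by blast
    have Uh: "openin (top_of_set X) (U (h j))" "U (h j) \<noteq> {}" if "j \<in> {1..?n}" for j
      using U bij_betwE[OF h] that unfolding open_family_def by blast+
    let ?O = "Pi\<^sub>E {1..?n} (\<lambda>j. U (h j))"
    have "openin (power_space X ?n) ?O"
      unfolding power_space_def using Uh by (subst openin_PiE) auto
    moreover have "?O \<noteq> {}"
      using Uh by (auto simp: PiE_eq_empty_iff)
    ultimately have "Prox X T ?n \<inter> ?O \<noteq> {}"
      using dense[OF n] unfolding dense_in_def dense_intersects_open by blast
    then obtain x where "x \<in> Prox X T ?n" "x \<in> ?O"
      by blast
    then have x: "x j \<in> U (h j)" if "j \<in> {1..?n}" for j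
      using that by (meson PiE_mem)
    have "\<forall>\<delta>>0. \<exists>m\<ge>1. diameter ((\<lambda>i. (T ^^ m) (x i)) ` {1..?n}) < \<delta>"
      using \<open>x \<in> Prox X T ?n\<close> unfolding Prox_def by simp
    then obtain m where m: "diameter ((\<lambda>i. (T ^^ m) (x i)) ` {1..?n}) < \<epsilon> / 2"
      using \<open>\<epsilon> > 0\<close> half_gt_zero by blast
    have close: "dist ((T ^^ m) (x i)) ((T ^^ m) (x j)) < \<epsilon> / 2" if "i \<in> {1..?n}" "j \<in> {1..?n}" for i j
    proof -
      have "dist ((T ^^ m) (x i)) ((T ^^ m) (x j)) \<le> diameter ((\<lambda>i. (T ^^ m) (x i)) ` {1..?n})"
        using that by (intro diameter_bounded_bound finite_imp_bounded) auto
      then show ?thesis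
        using m by linarith
    qed
    \<comment> \<open>Any entry of the contracted tuple can serve as the common centre.\<close>
    define c where "c = (T ^^ m) (x 1)"
    define V where "V i = U i \<inter> {y \<in> X. dist ((T ^^ m) y) c < \<epsilon> / 2}" for i
    have "openin (top_of_set X) (V i) \<and> V i \<noteq> {}" if i: "i \<in> I" for i
    proof
      show "openin (top_of_set X) (V i)"
        unfolding V_def using U i dynamical_system_funpow(1)[OF ds]
        by (intro openin_Int openin_ball_vimage) (auto simp: open_family_def)
      obtain j where j: "j \<in> {1..?n}" "h j = i"
        using h i by (metis bij_betw_def imageE)
      have "x j \<in> U i"
        using x j by blast
      moreover have "U i \<subseteq> X"
        using U i openin_imp_subset unfolding open_family_def by blast
      moreover have "dist ((T ^^ m) (x j)) c < \<epsilon> / 2"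
        using close[of j 1] j(1) n unfolding c_def by simp
      ultimately show "V i \<noteq> {}"
        by (auto simp: V_def)
    qed
    moreover have "near_collapse T k (\<Union>i\<in>I. V i)"
    proof -
      have "dist ((T ^^ m) y) ((T ^^ m) z) < \<epsilon>" if "y \<in> (\<Union>i\<in>I. V i)" "z \<in> (\<Union>i\<in>I. V i)" for y z
        using that dist_triangle_half_l[of "(T ^^ m) y" c \<epsilon> "(T ^^ m) z"] by (auto simp: V_def)
      then show ?thesis
        unfolding near_collapse_def \<epsilon>_def by blast
    qed
    moreover have "\<forall>i\<in>I. V i \<subseteq> U i"
      by (auto simp: V_def)
    ultimately show ?thesis
      unfolding open_family_def by blast
  qed
qed

section \<open>From approximate to exact rigidity and proximality\<close>

lemma uniformly_rigid_if_near_returns: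
  assumes "\<And>k. k \<ge> N \<Longrightarrow> near_return T k K"
  shows "uniformly_rigid T K"
  unfolding uniformly_rigid_def
proof (intro allI impI)
  fix \<epsilon> :: real assume "\<epsilon> > 0"
  then obtain k where k: "inverse (real (Suc k)) < \<epsilon>"
    using reals_Archimedean by blast
  let ?k = "Suc (max N k)"
  obtain n where n: "n \<ge> ?k" "\<forall>x\<in>K. dist ((T ^^ n) x) x < inverse (Suc ?k)"
    using assms[of ?k] unfolding near_return_def by (meson le_SucI max.cobounded1)
  have "inverse (real (Suc ?k)) \<le> inverse (real (Suc k))"
    by (intro le_imp_inverse_le) auto
  then have "\<forall>x\<in>K. dist ((T ^^ n) x) x < \<epsilon>"
    using n(2) k by (meson le_less_trans less_trans)
  then show "\<exists>n\<ge>1. \<forall>x\<in>K. dist ((T ^^ n) x) x < \<epsilon>"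
    using n(1) by (intro exI[of _ n]) simp
qed

text \<open>
  A point of the union lies in \<open>C N\<close> for all large \<open>N\<close>, so the return times of the stages
  converge on it. They need not increase from one stage to the next, hence the passage to a subsequence.
\<close>

lemma rigid_if_near_returns:
  assumes mono: "\<And>N. C N \<subseteq> C (Suc N)" and ret: "\<And>N. N \<ge> 1 \<Longrightarrow> near_return T N (C N)"
  shows "rigid T (\<Union>N\<in>{1..}. C N)"
proof -
  have C_mono: "C M \<subseteq> C N" if "M \<le> N" for M N
    using lift_Suc_mono_le[of C, OF mono that] .
  have "\<forall>k. \<exists>n. k \<ge> 1 \<longrightarrow> n \<ge> k \<and> (\<forall>x\<in>C k. dist ((T ^^ n) x) x < inverse (Suc k))"
    using ret unfolding near_return_def by blast
  then obtain n where n: "\<And>k. k \<ge> 1 \<Longrightarrow> n k \<ge> k"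
    "\<And>k x. k \<ge> 1 \<Longrightarrow> x \<in> C k \<Longrightarrow> dist ((T ^^ n k) x) x < inverse (Suc k)"
    by metis
  \<comment> \<open>The stage \<open>r (Suc j)\<close> exceeds the return time of stage \<open>r j\<close>, and its own return time is at least \<open>r (Suc j)\<close>.\<close>
  define r where "r = rec_nat 1 (\<lambda>_ m. Suc (m + n m))"
  have r: "r 0 = 1" "\<And>j. r (Suc j) = Suc (r j + n (r j))"
    by (simp_all add: r_def)
  have r_ge: "r j \<ge> Suc j" for j
    by (induction j) (auto simp: r)
  have "n (r j) < n (r (Suc j))" for j
    using n(1)[of "r (Suc j)"] r by simp
  then have smono: "strict_mono (n \<circ> r)"
    by (simp add: strict_mono_Suc_iff)
  have "(\<lambda>j. (T ^^ (n \<circ> r) j) x) \<longlonglongrightarrow> x" if x: "x \<in> (\<Union>N\<in>{1..}. C N)" for x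
  proof (rule metric_LIMSEQ_I)
    obtain N where N: "x \<in> C N"
      using x by blast
    fix \<epsilon> :: real assume "\<epsilon> > 0"
    then obtain k where k: "inverse (real (Suc k)) < \<epsilon>"
      using reals_Archimedean by blast
    have "dist ((T ^^ (n \<circ> r) j) x) x < \<epsilon>" if "j \<ge> max k N" for j
    proof -
      have le: "max k N \<le> r j" "r j \<ge> 1"
        using that r_ge[of j] by linarith+
      then have "x \<in> C (r j)"
        using N C_mono[of N "r j"] by auto
      then have "dist ((T ^^ (n \<circ> r) j) x) x < inverse (real (Suc (r j)))"
        using n(2) le(2) by simp
      also have "\<dots> \<le> inverse (real (Suc k))"
        using le(1) by (intro le_imp_inverse_le) auto
      finally show ?thesis
        using k by simp
    qed
    then show "\<exists>M. \<forall>j\<ge>M. dist ((T ^^ (n \<circ> r) j) x) x < \<epsilon>"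
      by blast
  qed
  then show ?thesis
    unfolding rigid_def using smono by blast
qed

lemma uniformly_proximal_if_near_collapses:
  assumes "\<And>k. k \<ge> N \<Longrightarrow> near_collapse T k K"
  shows "uniformly_proximal T K"
  unfolding uniformly_proximal_def
proof (intro allI impI)
  fix \<epsilon> :: real assume "\<epsilon> > 0"
  show "\<exists>n. diameter ((T ^^ n) ` K) < \<epsilon>"
  proof (cases "K = {}")
    case True
    then show ?thesis
      using \<open>\<epsilon> > 0\<close> by simp
  next
    case False
    obtain k where k: "inverse (real (Suc k)) < \<epsilon>"
      using reals_Archimedean \<open>\<epsilon> > 0\<close> by blast
    let ?k = "max N k"
    obtain m where m: "\<forall>x\<in>K. \<forall>y\<in>K. dist ((T ^^ m) x) ((T ^^ m) y) < inverse (Suc ?k)"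
      using assms[of ?k] unfolding near_collapse_def by (meson max.cobounded1)
    let ?S = "(T ^^ m) ` K"
    have "diameter ?S = (SUP (x, y)\<in>?S \<times> ?S. dist x y)"
      using False by (simp add: diameter_def)
    also have "\<dots> \<le> inverse (real (Suc ?k))"
    proof (rule cSUP_least)
      show "?S \<times> ?S \<noteq> {}"
        using False by simp
      fix z assume "z \<in> ?S \<times> ?S"
      then obtain x y where "z = ((T ^^ m) x, (T ^^ m) y)" "x \<in> K" "y \<in> K"
        by blast
      then show "(case z of (x, y) \<Rightarrow> dist x y) \<le> inverse (real (Suc ?k))"
        using m by (simp only: prod.case less_imp_le)
    qed
    also have "\<dots> \<le> inverse (real (Suc k))"
      by (intro le_imp_inverse_le) auto
    finally show ?thesis
      using k by (intro exI[of _ m]) simp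
  qed
qed

text \<open>
  A finite subset of an increasing union already lies in one of its members.
\<close>

lemma proximal_if_near_collapses:
  assumes mono: "\<And>N. C N \<subseteq> C (Suc N)" and coll: "\<And>N. N \<ge> 1 \<Longrightarrow> near_collapse T N (C N)"
  shows "proximal T (\<Union>N\<in>{1..}. C N)"
  unfolding proximal_def
proof (intro allI impI)
  fix F assume F: "finite F \<and> F \<subseteq> (\<Union>N\<in>{1..}. C N)"
  have C_mono: "C M \<subseteq> C N" if "M \<le> N" for M N
    using lift_Suc_mono_le[of C, OF mono that] .
  have "\<exists>N\<ge>1. F \<subseteq> C N"
    using conjunct1[OF F] conjunct2[OF F]
  proof (induction F rule: finite_induct)
    case (insert x F)
    then obtain M N where "M \<ge> 1" "F \<subseteq> C M" "x \<in> C N"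
      by auto
    then have "insert x F \<subseteq> C (max M N)"
      using C_mono[of M "max M N"] C_mono[of N "max M N"] by auto
    then show ?case
      using \<open>M \<ge> 1\<close> by (meson max.coboundedI1)
  qed auto
  then obtain N where N: "N \<ge> 1" "F \<subseteq> C N"
    by blast
  have "near_collapse T k F" if "k \<ge> N" for k
    using near_collapse_subset[of F "C k"] N C_mono[OF that] coll[of k] that by auto
  then show "uniformly_proximal T F"
    by (rule uniformly_proximal_if_near_collapses)
qed

theorem theorem2p6:
  fixes X :: "'a::metric_space set" and T :: "'a \<Rightarrow> 'a"
  assumes "dynamical_system X T"
    and "topologically_transitive X T"
    and "\<not> (\<exists>x. x isolated_in X)"
  shows
    "(\<exists>C :: nat \<Rightarrow> 'a set.
        (\<forall>N\<ge>1. C N \<subseteq> X \<and> cantor_set (C N) \<and> C N \<subseteq> C (Suc N)) \<and>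
        dense_in (top_of_set X) (\<Union>N\<in>{1..}. C N) \<and>
        rigid T (\<Union>N\<in>{1..}. C N) \<and>
        (\<forall>N\<ge>1. uniformly_rigid T (C N))) \<and>
     ((\<forall>n\<ge>1. dense_in (power_space X n) (Prox X T n)) \<longrightarrow>
      (\<exists>C :: nat \<Rightarrow> 'a set.
        (\<forall>N\<ge>1. C N \<subseteq> X \<and> cantor_set (C N) \<and> C N \<subseteq> C (Suc N)) \<and>
        dense_in (top_of_set X) (\<Union>N\<in>{1..}. C N) \<and>
        rigid T (\<Union>N\<in>{1..}. C N) \<and>
        (\<forall>N\<ge>1. uniformly_rigid T (C N)) \<and>
        (\<forall>N\<ge>1. uniformly_proximal T (C N)) \<and>
        proximal T (\<Union>N\<in>{1..}. C N)))"
proof -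
  have X: "compact X" "X \<noteq> {}"
    using assms(1) by (auto simp: dynamical_system_def)
  \<comment> \<open>Both parts come from the same construction: \<open>Q\<close> is trivial in the first and collapse in the second.\<close>
  have construction: "\<exists>C :: nat \<Rightarrow> 'a set.
        (\<forall>N. C N \<subseteq> C (Suc N)) \<and>
        (\<forall>N\<ge>1. C N \<subseteq> X \<and> cantor_set (C N) \<and> C N \<subseteq> C (Suc N)) \<and>
        dense_in (top_of_set X) (\<Union>N\<in>{1..}. C N) \<and>
        rigid T (\<Union>N\<in>{1..}. C N) \<and>
        (\<forall>N\<ge>1. uniformly_rigid T (C N)) \<and>
        (\<forall>N\<ge>1. Q N (C N))"
    if hered: "\<forall>k A B. A \<subseteq> B \<longrightarrow> Q k B \<longrightarrow> Q k A"
      and shr: "\<forall>k (I :: bool list set). finite I \<longrightarrow> shrinks X I (Q k)" for Q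
  proof -
    let ?P = "\<lambda>k A. near_return T k A \<and> Q k A"
    have "\<exists>C. (\<forall>N\<ge>1. cantor_set (C N)) \<and> (\<forall>N. C N \<subseteq> X) \<and> (\<forall>N. C N \<subseteq> C (Suc N)) \<and>
        dense_in (top_of_set X) (\<Union>N\<in>{1..}. C N) \<and> (\<forall>N\<ge>1. ?P N (C N))"
    proof (rule increasing_cantor_sets[OF X assms(3), of ?P])
      show "?P k A" if "A \<subseteq> B" "?P k B" for k A B
        using that near_return_subset hered by blast
      show "shrinks X I (?P k)" if "finite I" for k and I :: "bool list set"
        using shrinks_near_return[OF assms(1,2) that] shr[rule_format, OF that] near_return_subset
        by (rule shrinks_conj)
    qed
    then obtain C where C: "\<And>N. N \<ge> 1 \<Longrightarrow> cantor_set (C N)" "\<And>N. C N \<subseteq> X"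
        "\<And>N. C N \<subseteq> C (Suc N)" "dense_in (top_of_set X) (\<Union>N\<in>{1..}. C N)"
        and P: "\<And>N. N \<ge> 1 \<Longrightarrow> ?P N (C N)"
      by blast
    have "rigid T (\<Union>N\<in>{1..}. C N)"
      using C(3) P by (intro rigid_if_near_returns) auto
    moreover have "uniformly_rigid T (C N)" if "N \<ge> 1" for N
    proof (rule uniformly_rigid_if_near_returns)
      fix k assume "k \<ge> N"
      then show "near_return T k (C N)"
        using near_return_subset[OF lift_Suc_mono_le[of C, OF C(3)]] P[of k] that by auto
    qed
    ultimately show ?thesis
      using C P by (intro exI[of _ C]) simp
  qed
  show ?thesis
  proof (intro conjI impI)
    show "\<exists>C :: nat \<Rightarrow> 'a set.
        (\<forall>N\<ge>1. C N \<subseteq> X \<and> cantor_set (C N) \<and> C N \<subseteq> C (Suc N)) \<and>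
        dense_in (top_of_set X) (\<Union>N\<in>{1..}. C N) \<and>
        rigid T (\<Union>N\<in>{1..}. C N) \<and>
        (\<forall>N\<ge>1. uniformly_rigid T (C N))"
    proof -
      have "\<forall>k (I :: bool list set). finite I \<longrightarrow> shrinks X I (\<lambda>_. True)"
        by (auto simp: shrinks_def)
      then show ?thesis
        using ex_forward[OF construction[of "\<lambda>_ _. True"]] by simp
    qed
  next
    assume dense: "\<forall>n\<ge>1. dense_in (power_space X n) (Prox X T n)"
    have shr: "\<forall>k (I :: bool list set). finite I \<longrightarrow> shrinks X I (near_collapse T k)"
      using shrinks_near_collapse[OF assms(1)] dense by blast
    have hered: "\<forall>k A B. A \<subseteq> B \<longrightarrow> near_collapse T k B \<longrightarrow> near_collapse T k A"
      using near_collapse_subset by blast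
    obtain C :: "nat \<Rightarrow> 'a set" where mono: "\<forall>N. C N \<subseteq> C (Suc N)"
      and C: "\<forall>N\<ge>1. C N \<subseteq> X \<and> cantor_set (C N) \<and> C N \<subseteq> C (Suc N)"
        "dense_in (top_of_set X) (\<Union>N\<in>{1..}. C N)" "rigid T (\<Union>N\<in>{1..}. C N)"
        "\<forall>N\<ge>1. uniformly_rigid T (C N)"
      and coll: "\<forall>N\<ge>1. near_collapse T N (C N)"
      using construction[of "near_collapse T", OF hered shr] by blast
    have "uniformly_proximal T (C N)" if "N \<ge> 1" for N
    proof (rule uniformly_proximal_if_near_collapses)
      fix k assume "k \<ge> N"
      then show "near_collapse T k (C N)"
        using near_collapse_subset[OF lift_Suc_mono_le[of C, OF mono[rule_format]]] coll that by auto
    qed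
    moreover have "proximal T (\<Union>N\<in>{1..}. C N)"
      using mono coll by (intro proximal_if_near_collapses) auto
    ultimately show "\<exists>C :: nat \<Rightarrow> 'a set.
        (\<forall>N\<ge>1. C N \<subseteq> X \<and> cantor_set (C N) \<and> C N \<subseteq> C (Suc N)) \<and>
        dense_in (top_of_set X) (\<Union>N\<in>{1..}. C N) \<and>
        rigid T (\<Union>N\<in>{1..}. C N) \<and>
        (\<forall>N\<ge>1. uniformly_rigid T (C N)) \<and>
        (\<forall>N\<ge>1. uniformly_proximal T (C N)) \<and>
        proximal T (\<Union>N\<in>{1..}. C N)"
      using C by (intro exI[of _ C]) simp
  qed
qed

end
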